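(* Let $W=\{w_1,\dots,w_n\}$ and $M=\{m_1,\dots,m_n\}$ be disjoint, fix a stable marriage mechanism $f$, and let $\mu_{\mathrm{id}}$ be the perfect marriage in which $w_i$ is married to $m_i$ for every $i$. Both the worst-case randomized query complexity (with arbitrary Boolean queries, each a function of the women's profile alone or of the men's profile alone) and the worst-case randomized two-party communication complexity (Alice holding the women's profile $\succ_W$, Bob the men's profile $\succ_M$) of determining whether $f(\succ_W,\succ_M)=\mu_{\mathrm{id}}$, over $\succ_W\in\mathcal F(W,M)$ and $\succ_M\in\mathcal F(M,W)$, are $\Omega(n^2)$.
   Context: $\mathcal F(W,M)$ is the set of profiles assigning each woman a total order on $M$; $\mathcal F(M,W)$ analogously for men. A perfect marriage is a bijection between $W$ and $M$. A pair $(w,m)$ is blocking for $\mu$ if $w$ prefers $m$ to her spouse in $\mu$ and $m$ prefers $w$ to his spouse in $\mu$; $\mu$ is stable if it has no blocking pair. A stable marriage mechanism is a function $f$ from $\mathcal F(W,M)\times\mathcal F(M,W)$ to perfect marriages such that $f(\succ_W,\succ_M)$ is stable with respect to $\succ_W,\succ_M$ for all inputs. Randomized algorithms/protocols must answer correctly with probability at least $2/3$ on every input; complexities are worst case over inputs and asymptotic in $n$. *)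

theory Defs
  imports "HOL-Probability.Probability"
begin

text \<open>Women are w_0..w_(n-1) and men m_0..m_(n-1), both indexed by {0..<n}
  (the two sides are kept apart by their roles, so W and M are disjoint).
  A preference list is a list of the other side's indices, most preferred first.
  A profile assigns to each agent i < n a strict total order (a permutation of [0..<n]);
  for canonicity it is [] outside {0..<n}.\<close>

type_synonym profile = "nat \<Rightarrow> nat list"

definition profiles :: "nat \<Rightarrow> profile set" where
  "profiles n = {P. (\<forall>i<n. distinct (P i) \<and> set (P i) = {0..<n}) \<and> (\<forall>i\<ge>n. P i = [])}"

definition prefers :: "nat list \<Rightarrow> nat \<Rightarrow> nat \<Rightarrow> bool" where
  "prefers l a b \<longleftrightarrow> (\<exists>i j. i < j \<and> j < length l \<and> l ! i = a \<and> l ! j = b)"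

text \<open>A perfect marriage: woman w is married to man mu w; a bijection of {0..<n}.\<close>
definition perfect_marriage :: "nat \<Rightarrow> (nat \<Rightarrow> nat) \<Rightarrow> bool" where
  "perfect_marriage n mu \<longleftrightarrow> bij_betw mu {0..<n} {0..<n}"

definition blocking_pair ::
  "nat \<Rightarrow> profile \<Rightarrow> profile \<Rightarrow> (nat \<Rightarrow> nat) \<Rightarrow> nat \<Rightarrow> nat \<Rightarrow> bool" where
  "blocking_pair n PW PM mu w m \<longleftrightarrow>
     w < n \<and> m < n \<and> prefers (PW w) m (mu w) \<and> prefers (PM m) w (the_inv_into {0..<n} mu m)"

definition stable :: "nat \<Rightarrow> profile \<Rightarrow> profile \<Rightarrow> (nat \<Rightarrow> nat) \<Rightarrow> bool" where
  "stable n PW PM mu \<longleftrightarrow> perfect_marriage n mu \<and> \<not> (\<exists>w m. blocking_pair n PW PM mu w m)"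

definition stable_mechanism :: "nat \<Rightarrow> (profile \<Rightarrow> profile \<Rightarrow> nat \<Rightarrow> nat) \<Rightarrow> bool" where
  "stable_mechanism n f \<longleftrightarrow>
     (\<forall>PW \<in> profiles n. \<forall>PM \<in> profiles n. stable n PW PM (f PW PM))"

definition is_identity_outcome :: "nat \<Rightarrow> (profile \<Rightarrow> profile \<Rightarrow> nat \<Rightarrow> nat) \<Rightarrow> profile \<Rightarrow> profile \<Rightarrow> bool" where
  "is_identity_outcome n f PW PM \<longleftrightarrow> (\<forall>i<n. f PW PM i = i)"

text \<open>A deterministic protocol tree: at each internal node either Alice or Bob sends a bit
  which is a function of her/his own input (the history is the position in the tree).\<close>
datatype ('a, 'b) protocol =
    Output bool
  | AliceSends "'a \<Rightarrow> bool" "('a, 'b) protocol" "('a, 'b) protocol"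
  | BobSends "'b \<Rightarrow> bool" "('a, 'b) protocol" "('a, 'b) protocol"

fun run_protocol :: "('a, 'b) protocol \<Rightarrow> 'a \<Rightarrow> 'b \<Rightarrow> bool" where
  "run_protocol (Output r) x y = r"
| "run_protocol (AliceSends g t0 t1) x y = run_protocol (if g x then t1 else t0) x y"
| "run_protocol (BobSends g t0 t1) x y = run_protocol (if g y then t1 else t0) x y"

fun protocol_cost :: "('a, 'b) protocol \<Rightarrow> nat" where
  "protocol_cost (Output r) = 0"
| "protocol_cost (AliceSends g t0 t1) = Suc (max (protocol_cost t0) (protocol_cost t1))"
| "protocol_cost (BobSends g t0 t1) = Suc (max (protocol_cost t0) (protocol_cost t1))"

text \<open>A (public-coin) randomized protocol is a probability distribution over deterministic
  protocols. It computes g on X \<times> Y with cost at most d if it is correct with probability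
  at least 2/3 on every input and every protocol in its support has cost at most d.\<close>
definition rand_protocol_computes ::
  "('a, 'b) protocol pmf \<Rightarrow> 'a set \<Rightarrow> 'b set \<Rightarrow> ('a \<Rightarrow> 'b \<Rightarrow> bool) \<Rightarrow> nat \<Rightarrow> bool" where
  "rand_protocol_computes D X Y g d \<longleftrightarrow>
     (\<forall>x\<in>X. \<forall>y\<in>Y. measure_pmf.prob D {t. run_protocol t x y = g x y} \<ge> 2/3)
     \<and> (\<forall>t\<in>set_pmf D. protocol_cost t \<le> d)"

datatype ('a, 'b) query_tree =
    Answer bool
  | QueryW "'a \<Rightarrow> bool" "('a, 'b) query_tree" "('a, 'b) query_tree"
  | QueryM "'b \<Rightarrow> bool" "('a, 'b) query_tree" "('a, 'b) query_tree"

fun eval_query_tree :: "('a, 'b) query_tree \<Rightarrow> 'a \<Rightarrow> 'b \<Rightarrow> bool" where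
  "eval_query_tree (Answer r) x y = r"
| "eval_query_tree (QueryW q t0 t1) x y = eval_query_tree (if q x then t1 else t0) x y"
| "eval_query_tree (QueryM q t0 t1) x y = eval_query_tree (if q y then t1 else t0) x y"

fun query_depth :: "('a, 'b) query_tree \<Rightarrow> nat" where
  "query_depth (Answer r) = 0"
| "query_depth (QueryW q t0 t1) = Suc (max (query_depth t0) (query_depth t1))"
| "query_depth (QueryM q t0 t1) = Suc (max (query_depth t0) (query_depth t1))"

definition rand_query_computes ::
  "('a, 'b) query_tree pmf \<Rightarrow> 'a set \<Rightarrow> 'b set \<Rightarrow> ('a \<Rightarrow> 'b \<Rightarrow> bool) \<Rightarrow> nat \<Rightarrow> bool" where
  "rand_query_computes D X Y g d \<longleftrightarrow>
     (\<forall>x\<in>X. \<forall>y\<in>Y. measure_pmf.prob D {t. eval_query_tree t x y = g x y} \<ge> 2/3)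
     \<and> (\<forall>t\<in>set_pmf D. query_depth t \<le> d)"

end

theory Submission
  imports Defs
begin

text \<open>
  Set disjointness on N = k (n - k) bits, k = n div 2, embeds into the problem. Alice's and Bob's
  sets X and Y consist of pairs (w, m) with w < k and k \<le> m; woman w ranks the men m with
  (w, m) in X above man w, man m ranks the women w with (w, m) in Y above woman m, and everyone
  ranks all others below the partner of the same index. A common pair blocks the identity
  marriage. If there is none, the identity is the only stable marriage, so the choice made by the
  mechanism does not matter.

  The randomized lower bound for disjointness follows the information-complexity argument with
  entropy replaced by an exponential moment bound. Split the coordinates at random into a part D
  on which only Alice's bits are free and its complement on which only Bob's are, and draw the
  free bits uniformly. A protocol of cost d partitions this cube into at most 2^d parts, and a part
  of density r has squared coordinate biases summing to at most 2 ln (1/r). Hence on average over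
  the coordinates i the transcript distribution moves only by O(d/N) in squared Hellinger distance
  when the free bit at i is flipped. As parts are rectangles, cut-and-paste then makes the
  transcripts for (0,0) and (1,1) at i close as well. The protocol must tell these apart, so d is
  at least of order N.
\<close>

section \<open>Biases of subsets of the cube\<close>

text \<open>This is cosh b <= exp (b^2 / 2), the sub-Gaussian bound for a fair sign. For b >= 0 it
  is the inequality behind Hoeffding's lemma at p = 1/2 and h = 2 * b; the rest is symmetry in
  b.\<close>

lemma exp_add_exp_minus_le:
  fixes b :: real
  shows "exp b + exp (- b) \<le> 2 * exp (b\<^sup>2 / 2)"
proof -
  have *: "exp b + exp (- b) \<le> 2 * exp (b\<^sup>2 / 2)" if b: "b \<ge> 0" for b :: real
  proof -
    have "- b + ln ((1 + exp (2 * b)) / 2) \<le> b\<^sup>2 / 2"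
      using Hoeffdings_lemma_aux[of "2 * b" "1/2"] b
      by (simp add: power2_eq_square field_simps)
    hence "ln ((1 + exp (2 * b)) / 2) \<le> b + b\<^sup>2 / 2" by simp
    moreover have "(1 + exp (2 * b)) / 2 > 0" by (simp add: add_pos_pos)
    ultimately have "(1 + exp (2 * b)) / 2 \<le> exp (b + b\<^sup>2 / 2)"
      by (metis exp_le_cancel_iff exp_ln)
    hence "1 + exp (2 * b) \<le> 2 * (exp b * exp (b\<^sup>2 / 2))" by (simp add: exp_add)
    hence "exp (-b) * (1 + exp (2 * b)) \<le> exp (-b) * (2 * (exp b * exp (b\<^sup>2 / 2)))"
      by (intro mult_left_mono) auto
    moreover have "exp (-b) * (1 + exp (2 * b)) = exp b + exp (-b)"
      by (simp add: distrib_left flip: exp_add)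
    moreover have "exp (-b) * (2 * (exp b * exp (b\<^sup>2 / 2))) = 2 * exp (b\<^sup>2 / 2)"
      by (simp flip: exp_add)
    ultimately show ?thesis by simp
  qed
  show ?thesis using *[of b] *[of "-b"] by (cases "b \<ge> 0") auto
qed

text \<open>\<open>b i\<close> is the mean over S of the sign of coordinate i. On S the linear form
  with coefficients \<open>b\<close> has mean m, the sum of the squared biases, so by convexity its
  exponential sums to at least card S * exp m there. Over the whole cube that sum factors into terms
  2 * cosh (b i), which gives at most 2^|I| * exp (m / 2).\<close>

lemma level_one_inequality:
  fixes I :: "'i set" and S :: "'i set set"
  assumes I: "finite I" and S: "S \<subseteq> Pow I" "S \<noteq> {}"
  defines "b \<equiv> \<lambda>i. (real (card {Z\<in>S. i \<in> Z}) - real (card {Z\<in>S. i \<notin> Z})) / real (card S)"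
  shows "real (card S) * exp ((\<Sum>i\<in>I. (b i)\<^sup>2) / 2) \<le> 2 ^ card I"
proof -
  have finS: "finite S" using I S(1) by (simp add: finite_subset)
  have cS: "real (card S) > 0" using finS S(2) by (simp add: card_gt_0_iff)
  define m where "m = (\<Sum>i\<in>I. (b i)\<^sup>2)"
  define v where "v = (\<lambda>Z. \<Sum>i\<in>I. b i * (if i \<in> Z then 1 else -1))"
  have s: "(\<Sum>Z\<in>S. if i \<in> Z then 1 else -1) = real (card S) * b i" for i
  proof -
    have "(\<Sum>Z\<in>S. if i \<in> Z then 1 else -1::real)
        = (\<Sum>Z\<in>{Z\<in>S. i \<in> Z}. 1) + (\<Sum>Z\<in>{Z\<in>S. i \<notin> Z}. - 1)"
      using finS by (subst sum.If_cases) (auto simp: Int_def Collect_neg_eq)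
    thus ?thesis using cS by (simp add: b_def)
  qed
  have "(\<Sum>Z\<in>S. v Z) = (\<Sum>i\<in>I. b i * (\<Sum>Z\<in>S. if i \<in> Z then 1 else -1))"
    unfolding v_def sum_distrib_left by (rule sum.swap)
  also have "\<dots> = real (card S) * m"
    unfolding s m_def sum_distrib_left by (simp add: power2_eq_square algebra_simps)
  finally have sv: "(\<Sum>Z\<in>S. v Z) = real (card S) * m" .
  \<comment> \<open>Tangent line of exp at m: the corrections v Z - m sum to zero over S.\<close>
  have "real (card S) * exp m = (\<Sum>Z\<in>S. exp m * (1 + (v Z - m)))"
    by (simp add: sum.distrib sum_subtractf sv flip: sum_distrib_left)
  also have "\<dots> \<le> (\<Sum>Z\<in>S. exp (v Z))"
  proof (rule sum_mono)
    fix Z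
    have "exp m * (1 + (v Z - m)) \<le> exp m * exp (v Z - m)"
      by (intro mult_left_mono exp_ge_add_one_self) auto
    thus "exp m * (1 + (v Z - m)) \<le> exp (v Z)" by (simp flip: exp_add)
  qed
  also have "\<dots> \<le> (\<Sum>Z\<in>Pow I. exp (v Z))"
    using I S by (intro sum_mono2) auto
  also have "\<dots> = (\<Sum>Z\<in>Pow I. (\<Prod>i\<in>Z. exp (b i)) * (\<Prod>i\<in>I - Z. exp (- b i)))"
  proof (rule sum.cong[OF refl])
    fix Z assume Z: "Z \<in> Pow I"
    hence fin: "finite Z" "finite (I - Z)" using I finite_subset by auto
    have "v Z = (\<Sum>i\<in>Z. b i) + (\<Sum>i\<in>I - Z. - b i)"
      unfolding v_def using Z I
      by (subst sum.subset_diff[of Z I]) auto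
    thus "exp (v Z) = (\<Prod>i\<in>Z. exp (b i)) * (\<Prod>i\<in>I - Z. exp (- b i))"
      using fin by (simp only: exp_add exp_sum)
  qed
  also have "\<dots> = (\<Prod>i\<in>I. exp (b i) + exp (- b i))"
    using I by (simp add: prod_add)
  also have "\<dots> \<le> (\<Prod>i\<in>I. 2 * exp ((b i)\<^sup>2 / 2))"
    by (intro prod_mono conjI exp_add_exp_minus_le) (auto intro: add_nonneg_nonneg)
  also have "\<dots> = 2 ^ card I * exp (m / 2)"
    using I by (simp add: prod.distrib m_def sum_divide_distrib exp_sum)
  finally have "real (card S) * exp m \<le> 2 ^ card I * exp (m / 2)" .
  hence "(real (card S) * exp (m / 2)) * exp (m / 2) \<le> 2 ^ card I * exp (m / 2)"
    by (simp add: mult.assoc flip: exp_add)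
  thus ?thesis unfolding m_def by simp
qed

text \<open>Factor p - q as (sqrt p - sqrt q) * (sqrt p + sqrt q); the square of the second factor
  is at least p + q. This converts squared biases into squared Hellinger distances.\<close>

lemma sqrt_diff_squared_le:
  fixes p q :: real
  assumes "p \<ge> 0" "q \<ge> 0"
  shows "(sqrt p - sqrt q)\<^sup>2 \<le> (p - q)\<^sup>2 / (p + q)"
proof (cases "p + q = 0")
  \<comment> \<open>Here p = q = 0, and the quotient by zero is 0.\<close>
  case True
  thus ?thesis using assms by (auto simp: add_nonneg_eq_0_iff)
next
  case False
  hence pos: "p + q > 0" using assms by linarith
  have "p - q = (sqrt p - sqrt q) * (sqrt p + sqrt q)"
    using assms by (simp add: algebra_simps)
  hence "(p - q)\<^sup>2 = (sqrt p - sqrt q)\<^sup>2 * (sqrt p + sqrt q)\<^sup>2"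
    by (simp add: power_mult_distrib)
  moreover have "p + q \<le> (sqrt p + sqrt q)\<^sup>2"
    using assms by (simp add: power2_sum)
  ultimately have "(sqrt p - sqrt q)\<^sup>2 * (p + q) \<le> (p - q)\<^sup>2"
    by (simp add: mult_left_mono)
  thus ?thesis using pos by (simp add: field_simps)
qed

text \<open>A part \<open>S l\<close> contributes at most its size times the sum of its squared
  biases, which \<open>level_one_inequality\<close> controls through an exponential. Linearising
  around d replaces entropy: the exponentials of the at most 2^d parts together cost no more than
  the 2^|I| that the tangent line saves.\<close>

lemma sum_hellinger_le:
  fixes I :: "'i set" and f :: "'i set \<Rightarrow> 'l"
  assumes I: "finite I" and L: "finite L" "card L \<le> 2 ^ d" and f: "f ` Pow I \<subseteq> L"
  defines "c \<equiv> \<lambda>l P. real (card {Z\<in>Pow I. f Z = l \<and> P Z})"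
  shows "(\<Sum>i\<in>I. \<Sum>l\<in>L. (sqrt (c l (\<lambda>Z. i \<in> Z)) - sqrt (c l (\<lambda>Z. i \<notin> Z)))\<^sup>2)
           \<le> 2 * real d * 2 ^ card I"
proof -
  define S where "S = (\<lambda>l. {Z\<in>Pow I. f Z = l})"
  define b where "b = (\<lambda>l i. (c l (\<lambda>Z. i \<in> Z) - c l (\<lambda>Z. i \<notin> Z)) / real (card (S l)))"
  have finS: "finite (S l)" for l using I by (simp add: S_def)
  have csum: "c l (\<lambda>Z. i \<in> Z) + c l (\<lambda>Z. i \<notin> Z) = real (card (S l))" for l i
  proof -
    have "S l = {Z\<in>Pow I. f Z = l \<and> i \<in> Z} \<union> {Z\<in>Pow I. f Z = l \<and> i \<notin> Z}"
      by (auto simp: S_def)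
    also have "card \<dots> = card {Z\<in>Pow I. f Z = l \<and> i \<in> Z} + card {Z\<in>Pow I. f Z = l \<and> i \<notin> Z}"
      using I by (intro card_Un_disjoint) auto
    finally show ?thesis by (simp add: c_def)
  qed
  have one: "(\<Sum>i\<in>I. (sqrt (c l (\<lambda>Z. i \<in> Z)) - sqrt (c l (\<lambda>Z. i \<notin> Z)))\<^sup>2)
      \<le> 2 * (real (card (S l)) * (real d - 1) + exp (- real d) * 2 ^ card I)" for l
  proof (cases "S l = {}")
    case True
    have "c l (\<lambda>Z. i \<in> Z) = 0 \<and> c l (\<lambda>Z. i \<notin> Z) = 0" for i
      using csum[of l i] True by (simp add: c_def)
    thus ?thesis using True by simp
  next
    case False
    have cS: "real (card (S l)) > 0" using finS False by (simp add: card_gt_0_iff)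
    define x where "x = (\<Sum>i\<in>I. (b l i)\<^sup>2) / 2"
    have "(\<Sum>i\<in>I. (sqrt (c l (\<lambda>Z. i \<in> Z)) - sqrt (c l (\<lambda>Z. i \<notin> Z)))\<^sup>2)
      \<le> (\<Sum>i\<in>I. real (card (S l)) * (b l i)\<^sup>2)"
    proof (rule sum_mono)
      fix i
      have "(sqrt (c l (\<lambda>Z. i \<in> Z)) - sqrt (c l (\<lambda>Z. i \<notin> Z)))\<^sup>2
        \<le> (c l (\<lambda>Z. i \<in> Z) - c l (\<lambda>Z. i \<notin> Z))\<^sup>2 / real (card (S l))"
        using sqrt_diff_squared_le[of "c l (\<lambda>Z. i \<in> Z)" "c l (\<lambda>Z. i \<notin> Z)"]
        by (simp add: csum) (simp add: c_def)
      also have "\<dots> = real (card (S l)) * (b l i)\<^sup>2"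
        using cS by (simp add: b_def power_divide power2_eq_square)
      finally show "(sqrt (c l (\<lambda>Z. i \<in> Z)) - sqrt (c l (\<lambda>Z. i \<notin> Z)))\<^sup>2 \<le> real (card (S l)) * (b l i)\<^sup>2" .
    qed
    also have "\<dots> = 2 * (real (card (S l)) * x)"
      by (simp add: x_def flip: sum_distrib_left)
    \<comment> \<open>The tangent bound x - d + 1 <= exp (x - d) leaves card (S l) * exp x, exactly
      the quantity in \<open>level_one_inequality\<close>.\<close>
    also have "real (card (S l)) * x \<le> real (card (S l)) * (real d - 1 + exp (x - real d))"
      using exp_ge_add_one_self[of "x - real d"] by (intro mult_left_mono) linarith+
    also have "\<dots> = real (card (S l)) * (real d - 1) + exp (- real d) * (real (card (S l)) * exp x)"
      by (simp add: algebra_simps exp_diff exp_minus divide_inverse)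
    also have "real (card (S l)) * exp x \<le> 2 ^ card I"
    proof -
      have "{Z \<in> S l. Q Z} = {Z\<in>Pow I. f Z = l \<and> Q Z}" for Q by (auto simp: S_def)
      moreover have "S l \<subseteq> Pow I" by (auto simp: S_def)
      ultimately show ?thesis
        using level_one_inequality[OF I, of "S l"] False by (simp add: x_def b_def c_def)
    qed
    finally show ?thesis by (simp add: mult_left_mono)
  qed
  have cardsum: "(\<Sum>l\<in>L. real (card (S l))) = 2 ^ card I"
  proof -
    have "(\<Sum>l\<in>L. card (S l)) = card (\<Union>l\<in>L. S l)"
      using L finS by (intro card_UN_disjoint[symmetric]) (auto simp: S_def)
    also have "(\<Union>l\<in>L. S l) = Pow I" using f by (auto simp: S_def)
    finally show ?thesis using I by (simp add: card_Pow flip: of_nat_sum)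
  qed
  have "(\<Sum>i\<in>I. \<Sum>l\<in>L. (sqrt (c l (\<lambda>Z. i \<in> Z)) - sqrt (c l (\<lambda>Z. i \<notin> Z)))\<^sup>2)
     = (\<Sum>l\<in>L. \<Sum>i\<in>I. (sqrt (c l (\<lambda>Z. i \<in> Z)) - sqrt (c l (\<lambda>Z. i \<notin> Z)))\<^sup>2)"
    by (rule sum.swap)
  also have "\<dots> \<le> (\<Sum>l\<in>L. 2 * (real (card (S l)) * (real d - 1) + exp (- real d) * 2 ^ card I))"
    by (intro sum_mono one)
  also have "\<dots> = 2 * (2 ^ card I * (real d - 1) + real (card L) * (exp (- real d) * 2 ^ card I))"
    by (simp add: sum.distrib cardsum flip: sum_distrib_left sum_distrib_right)
  \<comment> \<open>Since 2^d <= exp d, the exponential terms total at most 2^|I|, which cancels the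
    -1 in real d - 1.\<close>
  also have "real (card L) * (exp (- real d) * 2 ^ card I) \<le> 1 * 2 ^ card I"
  proof -
    have "real (card L) \<le> 2 ^ d" using L(2) by (metis of_nat_le_iff of_nat_numeral of_nat_power)
    also have "\<dots> \<le> exp 1 ^ d" using exp_ge_add_one_self[of 1] by (intro power_mono) auto
    also have "\<dots> = exp (real d)" by (simp flip: exp_of_nat_mult)
    finally have "real (card L) * exp (- real d) \<le> exp (real d) * exp (- real d)"
      by (intro mult_right_mono) auto
    hence "real (card L) * exp (- real d) \<le> 1" by (simp flip: exp_add)
    hence "real (card L) * exp (- real d) * 2 ^ card I \<le> 1 * 2 ^ card I"
      by (intro mult_right_mono) auto
    thus ?thesis by (simp add: mult.assoc)
  qed
  finally show ?thesis by (simp add: algebra_simps)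
qed

section \<open>Disjointness for deterministic rectangle partitions\<close>

lemma sum_eq_sum_fibres:
  fixes \<phi> :: "'l \<Rightarrow> real"
  assumes "finite A" "finite L" "h ` A \<subseteq> L"
  shows "(\<Sum>Z\<in>A. \<phi> (h Z)) = (\<Sum>l\<in>L. \<phi> l * real (card {Z\<in>A. h Z = l}))"
proof -
  have "(\<Sum>Z\<in>A. \<phi> (h Z)) = (\<Sum>l\<in>L. \<Sum>Z\<in>{Z\<in>A. h Z = l}. \<phi> (h Z))"
    using assms by (rule sum.group[symmetric])
  also have "\<dots> = (\<Sum>l\<in>L. \<phi> l * real (card {Z\<in>A. h Z = l}))"
    by (intro sum.cong refl) (simp add: mult.commute)
  finally show ?thesis .
qed

text \<open>In the application this pairs each split \<open>D\<close> that gives coordinate i to Bob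
  with the split \<open>insert i D\<close> that gives it to Alice.\<close>

lemma sum_Pow_split:
  fixes h :: "'i set \<Rightarrow> real"
  assumes "finite I" "i \<in> I"
  shows "(\<Sum>D\<in>Pow I. h D) = (\<Sum>D\<in>Pow (I - {i}). h (insert i D) + h D)"
proof -
  have "Pow I = insert i ` Pow (I - {i}) \<union> Pow (I - {i})"
    using assms Pow_insert[of i "I - {i}"] by (auto simp: insert_absorb)
  also have "sum h \<dots> = sum h (insert i ` Pow (I - {i})) + sum h (Pow (I - {i}))"
    using assms by (intro sum.union_disjoint) auto
  also have "sum h (insert i ` Pow (I - {i})) = (\<Sum>D\<in>Pow (I - {i}). h (insert i D))"
    by (subst sum.reindex) (auto simp: inj_on_def)
  finally show ?thesis by (simp add: sum.distrib)
qed

lemma card_Pow_remove: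
  assumes "finite I" "i \<in> I"
  shows "real (card (Pow (I - {i}))) = 2 ^ card I / 2"
proof -
  have "card I = Suc (card (I - {i}))" using assms by (rule card.remove)
  thus ?thesis using assms by (simp add: card_Pow del: card_Diff_insert)
qed

text \<open>The sets x and y are fixed additions to the free parts of the two inputs. If U reaches
  label l with some Y, and V with some X, the rectangle property gives label l to U and V together.
  So the fibre is a product of a set depending on x and a set depending on y.\<close>

lemma rectangle_count_product:
  fixes \<tau> :: "'i set \<Rightarrow> 'i set \<Rightarrow> 'l"
  assumes rect: "\<And>X Y X' Y'. \<tau> X Y = \<tau> X' Y' \<Longrightarrow> \<tau> X Y' = \<tau> X Y"
    and D: "D \<subseteq> J"
  shows "\<exists>a b. (\<forall>x. a x \<ge> (0::real)) \<and> (\<forall>y. b y \<ge> (0::real)) \<and>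
    (\<forall>x y. real (card {Z\<in>Pow J. \<tau> (Z \<inter> D \<union> x) (Z - D \<union> y) = l}) = a x * b y)"
proof -
  define A where "A = (\<lambda>x. {U\<in>Pow D. \<exists>Y. \<tau> (U \<union> x) Y = l})"
  define B where "B = (\<lambda>y. {V\<in>Pow (J - D). \<exists>X. \<tau> X (V \<union> y) = l})"
  have "card {Z\<in>Pow J. \<tau> (Z \<inter> D \<union> x) (Z - D \<union> y) = l} = card (A x \<times> B y)" for x y
  proof (rule bij_betw_same_card)
    show "bij_betw (\<lambda>Z. (Z \<inter> D, Z - D)) {Z\<in>Pow J. \<tau> (Z \<inter> D \<union> x) (Z - D \<union> y) = l} (A x \<times> B y)"
    proof (rule bij_betw_byWitness[where f' = "\<lambda>(U, V). U \<union> V"])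
      show "(\<lambda>(U, V). U \<union> V) ` (A x \<times> B y) \<subseteq> {Z\<in>Pow J. \<tau> (Z \<inter> D \<union> x) (Z - D \<union> y) = l}"
      proof clarify
        fix U V assume U: "U \<in> A x" and V: "V \<in> B y"
        have *: "(U \<union> V) \<inter> D = U" "(U \<union> V) - D = V" "U \<union> V \<subseteq> J"
          using U V D by (auto simp: A_def B_def)
        obtain Y X where XY: "\<tau> (U \<union> x) Y = l" "\<tau> X (V \<union> y) = l"
          using U V by (auto simp: A_def B_def)
        hence "\<tau> (U \<union> x) (V \<union> y) = l" using rect by metis
        thus "U \<union> V \<in> Pow J \<and> \<tau> ((U \<union> V) \<inter> D \<union> x) ((U \<union> V) - D \<union> y) = l" using * by simp
      qed
    qed (auto simp: A_def B_def)
  qed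
  thus ?thesis
    by (intro exI[of _ "\<lambda>x. real (card (A x))"] exI[of _ "\<lambda>y. real (card (B y))"])
       (simp add: card_cartesian_product)
qed

text \<open>Weighted AM-GM for |s| * |t|, with t^2 <= 2 * (p + q). The weights keep the term (p + q)
  / 12 small: after summation it uses up half of the advantage 1/3 that a correct protocol must
  have.\<close>

lemma abs_diff_le_hellinger:
  fixes p q :: real
  assumes "p \<ge> 0" "q \<ge> 0"
  shows "\<bar>p - q\<bar> \<le> 6 * (sqrt p - sqrt q)\<^sup>2 + (p + q) / 12"
proof -
  define s t where "s = sqrt p - sqrt q" and "t = sqrt p + sqrt q"
  have pq: "p - q = s * t" using assms by (simp add: s_def t_def algebra_simps)
  have t: "t\<^sup>2 \<le> 2 * (p + q)"
  proof -
    have "t\<^sup>2 + s\<^sup>2 = 2 * (p + q)"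
      using assms by (simp add: s_def t_def power2_sum power2_diff)
    thus ?thesis by (smt (verit) zero_le_power2)
  qed
  have "0 \<le> 6 * (\<bar>s\<bar> - \<bar>t\<bar> / 12)\<^sup>2" by simp
  also have "\<dots> = 6 * s\<^sup>2 + t\<^sup>2 / 24 - \<bar>s\<bar> * \<bar>t\<bar>"
    by (simp add: power2_diff power_divide)
  finally have "\<bar>p - q\<bar> \<le> 6 * s\<^sup>2 + t\<^sup>2 / 24" by (simp add: pq abs_mult)
  thus ?thesis using t unfolding s_def by linarith
qed

text \<open>Since the counts factor, the affinity of the labels for the inputs 00 and 11 equals that
  for the inputs 10 and 01, and the latter two are both close to 00.\<close>
lemma cut_and_paste:
  fixes a b :: "bool \<Rightarrow> 'l \<Rightarrow> real"
  assumes nonneg: "\<And>x l. l \<in> L \<Longrightarrow> a x l \<ge> 0" "\<And>y l. l \<in> L \<Longrightarrow> b y l \<ge> 0"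
    and p: "\<And>x y l. l \<in> L \<Longrightarrow> p x y l = a x l * b y l"
    and total: "\<And>x y. (\<Sum>l\<in>L. p x y l) = M"
  shows "(\<Sum>l\<in>L. \<bar>p False False l - p True True l\<bar>)
    \<le> 12 * ((\<Sum>l\<in>L. (sqrt (p True False l) - sqrt (p False False l))\<^sup>2)
          + (\<Sum>l\<in>L. (sqrt (p False True l) - sqrt (p False False l))\<^sup>2)) + M / 6"
proof -
  have pn: "p x y l \<ge> 0" if "l \<in> L" for x y l using nonneg p that by simp
  \<comment> \<open>For equal total masses the squared Hellinger distance is determined by the
    affinity, the sum of the products of square roots.\<close>
  have H: "(\<Sum>l\<in>L. (sqrt (p x y l) - sqrt (p x' y' l))\<^sup>2)
      = 2 * M - 2 * (\<Sum>l\<in>L. sqrt (p x y l) * sqrt (p x' y' l))" for x y x' y'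
  proof -
    have "(\<Sum>l\<in>L. (sqrt (p x y l) - sqrt (p x' y' l))\<^sup>2)
       = (\<Sum>l\<in>L. p x y l + p x' y' l - 2 * (sqrt (p x y l) * sqrt (p x' y' l)))"
      by (intro sum.cong refl) (simp add: power2_diff pn)
    thus ?thesis by (simp add: sum.distrib sum_subtractf total flip: sum_distrib_left)
  qed
  have "(\<Sum>l\<in>L. sqrt (p False False l) * sqrt (p True True l))
      = (\<Sum>l\<in>L. sqrt (p True False l) * sqrt (p False True l))"
    by (intro sum.cong refl) (simp add: p real_sqrt_mult)
  hence cp: "(\<Sum>l\<in>L. (sqrt (p False False l) - sqrt (p True True l))\<^sup>2)
      = (\<Sum>l\<in>L. (sqrt (p True False l) - sqrt (p False True l))\<^sup>2)"
    by (simp add: H)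
  have "(\<Sum>l\<in>L. \<bar>p False False l - p True True l\<bar>)
    \<le> (\<Sum>l\<in>L. 6 * (sqrt (p False False l) - sqrt (p True True l))\<^sup>2
            + (p False False l + p True True l) / 12)"
    by (intro sum_mono abs_diff_le_hellinger pn)
  also have "\<dots> = 6 * (\<Sum>l\<in>L. (sqrt (p True False l) - sqrt (p False True l))\<^sup>2) + M / 6"
    by (simp add: sum.distrib total flip: cp sum_distrib_left sum_divide_distrib)
  also have "(\<Sum>l\<in>L. (sqrt (p True False l) - sqrt (p False True l))\<^sup>2)
    \<le> (\<Sum>l\<in>L. 2 * (sqrt (p True False l) - sqrt (p False False l))\<^sup>2
            + 2 * (sqrt (p False True l) - sqrt (p False False l))\<^sup>2)"
  proof (rule sum_mono)
    fix l
    have "(u - v)\<^sup>2 \<le> 2 * (u - w)\<^sup>2 + 2 * (v - w)\<^sup>2" for u v w :: real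
    proof -
      have "2 * (u - w)\<^sup>2 + 2 * (v - w)\<^sup>2 - (u - v)\<^sup>2 = (u + v - 2 * w)\<^sup>2"
        by (simp add: power2_eq_square algebra_simps)
      thus ?thesis using zero_le_power2[of "u + v - 2 * w"] by linarith
    qed
    thus "(sqrt (p True False l) - sqrt (p False True l))\<^sup>2
      \<le> 2 * (sqrt (p True False l) - sqrt (p False False l))\<^sup>2
       + 2 * (sqrt (p False True l) - sqrt (p False False l))\<^sup>2"
      by blast
  qed
  finally show ?thesis by (simp add: sum.distrib flip: sum_distrib_left)
qed

text \<open>Alice's bits are those of Z in D, Bob's those outside D, so the two terms of the difference
  range over disjoint inputs and over inputs meeting exactly in i.\<close>
lemma disjointness_advantage_le:
  fixes I :: "'i set" and \<tau> :: "'i set \<Rightarrow> 'i set \<Rightarrow> 'l" and out :: "'l \<Rightarrow> bool"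
  assumes I: "finite I" and L: "finite L" "card L \<le> 2 ^ d" and \<tau>: "\<And>X Y. \<tau> X Y \<in> L"
    and rect: "\<And>X Y X' Y'. \<tau> X Y = \<tau> X' Y' \<Longrightarrow> \<tau> X Y' = \<tau> X Y"
  shows "(\<Sum>i\<in>I. \<Sum>D\<in>Pow (I - {i}). \<Sum>Z\<in>Pow (I - {i}).
            of_bool (out (\<tau> (Z \<inter> D) (Z - D)))
          - of_bool (out (\<tau> (insert i (Z \<inter> D)) (insert i (Z - D)))))
       \<le> 4 ^ card I * (24 * real d + real (card I) / 24)"
proof -
  define c where "c = (\<lambda>D l P. real (card {Z\<in>Pow I. \<tau> (Z \<inter> D) (Z - D) = l \<and> P Z}))"
  define h where "h = (\<lambda>i D. \<Sum>l\<in>L. (sqrt (c D l (\<lambda>Z. i \<in> Z)) - sqrt (c D l (\<lambda>Z. i \<notin> Z)))\<^sup>2)"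
  have step: "(\<Sum>Z\<in>Pow (I - {i}). of_bool (out (\<tau> (Z \<inter> D) (Z - D)))
          - of_bool (out (\<tau> (insert i (Z \<inter> D)) (insert i (Z - D)))))
      \<le> 12 * (h i (insert i D) + h i D) + 2 ^ card I / 12"
    if i: "i \<in> I" and D: "D \<in> Pow (I - {i})" for i D
  proof -
    define J where "J = I - {i}"
    \<comment> \<open>A party's bit at coordinate i, as the set to be added to its input.\<close>
    define \<iota> where "\<iota> = (\<lambda>x. if x then {i} else {})"
    define p where "p = (\<lambda>x y l. real (card {Z\<in>Pow J. \<tau> (Z \<inter> D \<union> \<iota> x) (Z - D \<union> \<iota> y) = l}))"
    have finJ: "finite (Pow J)" using I by (simp add: J_def)
    have "\<forall>l. \<exists>a b. (\<forall>x. a x \<ge> (0::real)) \<and> (\<forall>y. b y \<ge> (0::real)) \<and>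
        (\<forall>x y. real (card {Z\<in>Pow J. \<tau> (Z \<inter> D \<union> x) (Z - D \<union> y) = l}) = a x * b y)"
      using rectangle_count_product[of \<tau> D J] rect D unfolding J_def by blast
    from choice[OF this] obtain a :: "'l \<Rightarrow> 'i set \<Rightarrow> real" where
      "\<forall>l. \<exists>b. (\<forall>x. a l x \<ge> 0) \<and> (\<forall>y. b y \<ge> (0::real)) \<and>
        (\<forall>x y. real (card {Z\<in>Pow J. \<tau> (Z \<inter> D \<union> x) (Z - D \<union> y) = l}) = a l x * b y)" ..
    from choice[OF this] obtain b :: "'l \<Rightarrow> 'i set \<Rightarrow> real" where
      "\<forall>l. (\<forall>x. a l x \<ge> 0) \<and> (\<forall>y. b l y \<ge> 0) \<and>
        (\<forall>x y. real (card {Z\<in>Pow J. \<tau> (Z \<inter> D \<union> x) (Z - D \<union> y) = l}) = a l x * b l y)" ..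
    hence ab: "a l x \<ge> 0" "b l y \<ge> 0"
      "real (card {Z\<in>Pow J. \<tau> (Z \<inter> D \<union> x) (Z - D \<union> y) = l}) = a l x * b l y" for l x y
      by blast+
    have total: "(\<Sum>l\<in>L. p x y l) = 2 ^ card I / 2" for x y
    proof -
      have "(\<Sum>l\<in>L. p x y l) = (\<Sum>Z\<in>Pow J. 1)"
        using sum_eq_sum_fibres[OF finJ L(1), of "\<lambda>Z. \<tau> (Z \<inter> D \<union> \<iota> x) (Z - D \<union> \<iota> y)" "\<lambda>_. 1"] \<tau>
        by (simp add: p_def image_subset_iff)
      also have "\<dots> = 2 ^ card I / 2" using card_Pow_remove[OF I i] by (simp add: J_def)
      finally show ?thesis .
    qed
    \<comment> \<open>Moving i into Alice's part makes it one of her free bits, so splitting by i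
      compares 10 with 00; leaving it to Bob compares 01 with 00.\<close>
    have c_eq: "c (insert i D) l (\<lambda>Z. i \<in> Z) = p True False l"
      "c (insert i D) l (\<lambda>Z. i \<notin> Z) = p False False l"
      "c D l (\<lambda>Z. i \<in> Z) = p False True l"
      "c D l (\<lambda>Z. i \<notin> Z) = p False False l" for l
    proof -
      have iD: "i \<notin> D" using D by auto
      have with_i: "card {Z\<in>Pow I. Q Z \<and> i \<in> Z} = card {Z\<in>Pow J. Q (insert i Z)}" for Q
      proof -
        have "{Z\<in>Pow I. Q Z \<and> i \<in> Z} = insert i ` {Z\<in>Pow J. Q (insert i Z)}"
        proof (intro equalityI subsetI)
          fix Z assume "Z \<in> {Z\<in>Pow I. Q Z \<and> i \<in> Z}"
          thus "Z \<in> insert i ` {Z\<in>Pow J. Q (insert i Z)}"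
            by (intro image_eqI[of _ _ "Z - {i}"]) (auto simp: J_def insert_absorb)
        qed (use i in \<open>auto simp: J_def\<close>)
        moreover have "inj_on (insert i) {Z\<in>Pow J. Q (insert i Z)}"
          by (auto simp: inj_on_def J_def)
        ultimately show ?thesis by (simp add: card_image)
      qed
      have without_i: "{Z\<in>Pow I. Q Z \<and> i \<notin> Z} = {Z\<in>Pow J. Q Z}" for Q
        by (auto simp: J_def)
      have sets: "insert i Z \<inter> insert i D = Z \<inter> D \<union> {i}" "insert i Z - insert i D = Z - D"
        "Z \<inter> insert i D = Z \<inter> D" "Z - insert i D = Z - D"
        "insert i Z \<inter> D = Z \<inter> D" "insert i Z - D = Z - D \<union> {i}" if "Z \<in> Pow J" for Z
        using that iD by (auto simp: J_def)
      show "c (insert i D) l (\<lambda>Z. i \<in> Z) = p True False l"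
        "c (insert i D) l (\<lambda>Z. i \<notin> Z) = p False False l"
        "c D l (\<lambda>Z. i \<in> Z) = p False True l"
        "c D l (\<lambda>Z. i \<notin> Z) = p False False l"
        unfolding c_def p_def with_i without_i \<iota>_def
        using sets by (simp_all cong: conj_cong)
    qed
    have "(\<Sum>Z\<in>Pow (I - {i}). of_bool (out (\<tau> (Z \<inter> D) (Z - D)))
          - of_bool (out (\<tau> (insert i (Z \<inter> D)) (insert i (Z - D)))))
      = (\<Sum>l\<in>L. of_bool (out l) * p False False l) - (\<Sum>l\<in>L. of_bool (out l) * p True True l)"
      using sum_eq_sum_fibres[OF finJ L(1), of "\<lambda>Z. \<tau> (Z \<inter> D \<union> \<iota> False) (Z - D \<union> \<iota> False)" "\<lambda>l. of_bool (out l)"]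
        sum_eq_sum_fibres[OF finJ L(1), of "\<lambda>Z. \<tau> (Z \<inter> D \<union> \<iota> True) (Z - D \<union> \<iota> True)" "\<lambda>l. of_bool (out l)"] \<tau>
      by (simp add: p_def J_def \<iota>_def image_subset_iff sum_subtractf)
    also have "\<dots> = (\<Sum>l\<in>L. of_bool (out l) * (p False False l - p True True l))"
      by (simp add: sum_subtractf right_diff_distrib)
    also have "\<dots> \<le> (\<Sum>l\<in>L. \<bar>p False False l - p True True l\<bar>)"
      by (intro sum_mono) auto
    also have "\<dots> \<le> 12 * ((\<Sum>l\<in>L. (sqrt (p True False l) - sqrt (p False False l))\<^sup>2)
          + (\<Sum>l\<in>L. (sqrt (p False True l) - sqrt (p False False l))\<^sup>2)) + (2 ^ card I / 2) / 6"
      by (rule cut_and_paste[where a = "\<lambda>x l. a l (\<iota> x)" and b = "\<lambda>y l. b l (\<iota> y)"])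
         (use ab total in \<open>simp_all add: p_def\<close>)
    also have "\<dots> = 12 * (h i (insert i D) + h i D) + 2 ^ card I / 12"
      by (simp add: h_def c_eq)
    finally show ?thesis .
  qed
  have "(\<Sum>i\<in>I. \<Sum>D\<in>Pow (I - {i}). \<Sum>Z\<in>Pow (I - {i}).
            of_bool (out (\<tau> (Z \<inter> D) (Z - D)))
          - of_bool (out (\<tau> (insert i (Z \<inter> D)) (insert i (Z - D)))))
      \<le> (\<Sum>i\<in>I. \<Sum>D\<in>Pow (I - {i}). 12 * (h i (insert i D) + h i D) + 2 ^ card I / 12)"
    by (intro sum_mono step)
  also have "\<dots> = (\<Sum>i\<in>I. 12 * (\<Sum>D\<in>Pow I. h i D) + 4 ^ card I / 24)"
  proof (rule sum.cong[OF refl])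
    fix i assume i: "i \<in> I"
    have "real (card (Pow (I - {i}))) * (2 ^ card I / 12) = 4 ^ card I / 24"
      by (simp add: card_Pow_remove[OF I i] flip: power_mult_distrib)
    thus "(\<Sum>D\<in>Pow (I - {i}). 12 * (h i (insert i D) + h i D) + 2 ^ card I / 12)
        = 12 * (\<Sum>D\<in>Pow I. h i D) + 4 ^ card I / 24"
      by (simp add: sum_Pow_split[OF I i] sum.distrib flip: sum_distrib_left)
  qed
  also have "\<dots> = 12 * (\<Sum>D\<in>Pow I. \<Sum>i\<in>I. h i D) + 4 ^ card I / 24 * real (card I)"
    by (simp add: sum.distrib sum.swap[of _ "Pow I"] flip: sum_distrib_left)
  \<comment> \<open>For a fixed D the label is a function of Z alone, and
    \<open>sum_hellinger_le\<close> bounds all coordinates at once.\<close>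
  also have "(\<Sum>D\<in>Pow I. \<Sum>i\<in>I. h i D) \<le> (\<Sum>D\<in>Pow I. 2 * real d * 2 ^ card I)"
    unfolding h_def c_def
    by (intro sum_mono sum_hellinger_le[OF I L, of "\<lambda>Z. \<tau> (Z \<inter> _) (Z - _)"]) (use \<tau> in auto)
  also have "\<dots> = 2 * real d * 4 ^ card I"
    using I by (simp add: card_Pow flip: power_mult_distrib)
  finally show ?thesis by (simp add: algebra_simps)
qed

section \<open>Randomized protocols\<close>

fun transcript :: "('a, 'b) protocol \<Rightarrow> 'a \<Rightarrow> 'b \<Rightarrow> bool list" where
  "transcript (Output r) x y = []"
| "transcript (AliceSends g t0 t1) x y = g x # transcript (if g x then t1 else t0) x y"
| "transcript (BobSends g t0 t1) x y = g y # transcript (if g y then t1 else t0) x y"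

text \<open>Addresses of all leaves, including those that no input reaches. This gives a finite
  label set of size at most 2^cost for arbitrary input types.\<close>

fun transcripts :: "('a, 'b) protocol \<Rightarrow> bool list set" where
  "transcripts (Output r) = {[]}"
| "transcripts (AliceSends g t0 t1) = Cons False ` transcripts t0 \<union> Cons True ` transcripts t1"
| "transcripts (BobSends g t0 t1) = Cons False ` transcripts t0 \<union> Cons True ` transcripts t1"

lemma transcript_in_transcripts: "transcript t x y \<in> transcripts t"
  by (induction t) auto

lemma finite_transcripts: "finite (transcripts t)"
  by (induction t) auto

lemma card_transcripts_le: "card (transcripts t) \<le> 2 ^ protocol_cost t"
proof -
  have *: "card (Cons False ` A \<union> Cons True ` B) \<le> 2 ^ Suc (max m n)"
    if "card A \<le> 2 ^ m" "card B \<le> 2 ^ n" for A B and m n :: nat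
  proof -
    have "card (Cons False ` A \<union> Cons True ` B) \<le> card A + card B"
      by (rule order.trans[OF card_Un_le]) (simp add: card_image)
    also have "\<dots> \<le> 2 ^ max m n + 2 ^ max m n"
      using that by (intro add_mono) (auto elim!: order.trans intro: power_increasing)
    finally show ?thesis by simp
  qed
  show ?thesis by (induction t) (auto simp del: power_Suc intro: *)
qed

text \<open>Along the common path every bit depends on one input only. So on (x, y') Alice sends
  what she sends on (x, y), Bob what he sends on (x', y'), and the path is never left.\<close>

lemma transcript_rectangle:
  "transcript t x y = transcript t x' y' \<Longrightarrow> transcript t x y' = transcript t x y"
  by (induction t) (auto split: if_splits)

lemma run_protocol_eq_if_transcript_eq:
  "transcript t x y = transcript t x' y' \<Longrightarrow> run_protocol t x y = run_protocol t x' y'"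
  by (induction t) (auto split: if_splits)

lemma expectation_of_bool:
  "measure_pmf.expectation D (\<lambda>t. of_bool (P t)) = measure_pmf.prob D {t. P t}"
proof -
  have "(\<lambda>t. of_bool (P t)) = (indicator {t. P t} :: _ \<Rightarrow> real)" by auto
  thus ?thesis by simp
qed

text \<open>The encodings \<open>\<phi>\<close> and \<open>\<psi>\<close> make the bound applicable
  to any problem that disjointness reduces to. Averaging over the coins reduces it to deterministic
  protocols: the expected advantage is at least 1/3 per term, while
  \<open>disjointness_advantage_le\<close> caps the total for every protocol in the support.\<close>

lemma rand_disjointness_lower_bound:
  fixes D :: "('a, 'b) protocol pmf" and I :: "'i set"
  assumes I: "finite I" and cost: "\<And>t. t \<in> set_pmf D \<Longrightarrow> protocol_cost t \<le> d"
    and disjoint: "\<And>X Y. X \<subseteq> I \<Longrightarrow> Y \<subseteq> I \<Longrightarrow> X \<inter> Y = {} \<Longrightarrow>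
      measure_pmf.prob D {t. run_protocol t (\<phi> X) (\<psi> Y)} \<ge> 2 / 3"
    and intersecting: "\<And>X Y. X \<subseteq> I \<Longrightarrow> Y \<subseteq> I \<Longrightarrow> X \<inter> Y \<noteq> {} \<Longrightarrow>
      measure_pmf.prob D {t. run_protocol t (\<phi> X) (\<psi> Y)} \<le> 1 / 3"
  shows "real (card I) \<le> 576 * real d"
proof -
  define r :: "_ \<Rightarrow> _ \<Rightarrow> _ \<Rightarrow> real"
    where "r = (\<lambda>X Y t. of_bool (run_protocol t (\<phi> X) (\<psi> Y)))"
  define G where "G = (\<lambda>t. \<Sum>i\<in>I. \<Sum>C\<in>Pow (I - {i}). \<Sum>Z\<in>Pow (I - {i}).
      r (Z \<inter> C) (Z - C) t - r (insert i (Z \<inter> C)) (insert i (Z - C)) t)"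
  have int: "integrable (measure_pmf D) (r X Y)" for X Y
    unfolding r_def by (rule measure_pmf.integrable_const_bound[where B = 1]) auto
  have E: "measure_pmf.expectation D (r X Y) = measure_pmf.prob D {t. run_protocol t (\<phi> X) (\<psi> Y)}" for X Y
    unfolding r_def by (rule expectation_of_bool)
  have intG: "integrable (measure_pmf D) G"
    unfolding G_def by (intro Bochner_Integration.integrable_sum Bochner_Integration.integrable_diff int)
  have "4 ^ card I * (real (card I) / 12) = (\<Sum>i\<in>I. \<Sum>C\<in>Pow (I - {i}). \<Sum>Z\<in>Pow (I - {i}). 1 / 3)"
  proof -
    have "(\<Sum>C\<in>Pow (I - {i}). \<Sum>Z\<in>Pow (I - {i}). 1 / 3 :: real) = 4 ^ card I / 12" if i: "i \<in> I" for i
      by (simp add: card_Pow_remove[OF I i] flip: power_mult_distrib)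
    hence "(\<Sum>i\<in>I. \<Sum>C\<in>Pow (I - {i}). \<Sum>Z\<in>Pow (I - {i}). 1 / 3 :: real) = (\<Sum>i\<in>I. 4 ^ card I / 12)"
      by (rule sum.cong[OF refl])
    also have "\<dots> = 4 ^ card I * (real (card I) / 12)" by simp
    finally show ?thesis ..
  qed
  also have "\<dots> \<le> (\<Sum>i\<in>I. \<Sum>C\<in>Pow (I - {i}). \<Sum>Z\<in>Pow (I - {i}).
      measure_pmf.expectation D (r (Z \<inter> C) (Z - C))
      - measure_pmf.expectation D (r (insert i (Z \<inter> C)) (insert i (Z - C))))"
  proof (intro sum_mono)
    fix i C Z assume i: "i \<in> I" "C \<in> Pow (I - {i})" "Z \<in> Pow (I - {i})"
    have "measure_pmf.expectation D (r (Z \<inter> C) (Z - C)) \<ge> 2 / 3"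
      unfolding E using i by (intro disjoint) auto
    moreover have "measure_pmf.expectation D (r (insert i (Z \<inter> C)) (insert i (Z - C))) \<le> 1 / 3"
      unfolding E using i by (intro intersecting) auto
    ultimately show "1 / 3 \<le> measure_pmf.expectation D (r (Z \<inter> C) (Z - C))
      - measure_pmf.expectation D (r (insert i (Z \<inter> C)) (insert i (Z - C)))" by linarith
  qed
  also have "\<dots> = measure_pmf.expectation D G"
    unfolding G_def by (simp add: int)
  also have "\<dots> \<le> 4 ^ card I * (24 * real d + real (card I) / 24)"
  proof (rule measure_pmf.integral_le_const[OF intG], rule AE_pmfI)
    fix t assume t: "t \<in> set_pmf D"
    \<comment> \<open>Equal transcripts force equal outputs, so the output is a function of the
      label; labels that no input attains get False.\<close>
    define out where "out = (\<lambda>l. \<exists>x y. transcript t x y = l \<and> run_protocol t x y)"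
    have out: "run_protocol t x y \<longleftrightarrow> out (transcript t x y)" for x y
    proof
      assume "out (transcript t x y)"
      then obtain x' y' where "transcript t x' y' = transcript t x y" "run_protocol t x' y'"
        by (auto simp: out_def)
      thus "run_protocol t x y" using run_protocol_eq_if_transcript_eq[of t x' y' x y] by simp
    qed (auto simp: out_def)
    have "card (transcripts t) \<le> 2 ^ d"
      using card_transcripts_le[of t] cost[OF t] by (meson order.trans one_le_numeral power_increasing)
    thus "G t \<le> 4 ^ card I * (24 * real d + real (card I) / 24)"
      unfolding G_def r_def out
      by (intro disjointness_advantage_le[OF I finite_transcripts[of t],
            where \<tau> = "\<lambda>X Y. transcript t (\<phi> X) (\<psi> Y)"])
         (assumption | rule transcript_in_transcripts | erule transcript_rectangle)+
  qed
  \<comment> \<open>After division by 4^|I| this leaves |I| / 24 <= 24 * d, whence the constant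
    576.\<close>
  finally have "real (card I) / 12 \<le> 24 * real d + real (card I) / 24" by simp
  thus ?thesis by linarith
qed

section \<open>Query trees as protocols\<close>

fun protocol_of_query :: "('a, 'b) query_tree \<Rightarrow> ('a, 'b) protocol" where
  "protocol_of_query (Answer r) = Output r"
| "protocol_of_query (QueryW q t0 t1) = AliceSends q (protocol_of_query t0) (protocol_of_query t1)"
| "protocol_of_query (QueryM q t0 t1) = BobSends q (protocol_of_query t0) (protocol_of_query t1)"

lemma run_protocol_of_query: "run_protocol (protocol_of_query t) x y = eval_query_tree t x y"
  by (induction t) auto

lemma protocol_cost_of_query: "protocol_cost (protocol_of_query t) = query_depth t"
  by (induction t) auto

text \<open>The owner of a queried profile can announce the answer with one bit, so communication
  lower bounds carry over to queries with the same constant.\<close>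

lemma rand_protocol_of_rand_query:
  assumes "rand_query_computes D X Y g d"
  shows "rand_protocol_computes (map_pmf protocol_of_query D) X Y g d"
  using assms
  by (simp add: rand_query_computes_def rand_protocol_computes_def vimage_def
      run_protocol_of_query protocol_cost_of_query)

section \<open>Embedding disjointness into stable marriage\<close>

definition pref_list :: "nat \<Rightarrow> nat set \<Rightarrow> nat \<Rightarrow> nat list" where
  "pref_list n S a = filter (\<lambda>b. b \<in> S) [0..<n] @ a # filter (\<lambda>b. b \<notin> S \<and> b \<noteq> a) [0..<n]"

lemma prefers_before_iff:
  assumes "distinct (xs @ a # ys)"
  shows "prefers (xs @ a # ys) b a \<longleftrightarrow> b \<in> set xs"
proof
  assume "prefers (xs @ a # ys) b a"
  then obtain i j where ij: "i < j" "j < length (xs @ a # ys)" "(xs @ a # ys) ! i = b"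
    "(xs @ a # ys) ! j = a" by (auto simp: prefers_def)
  have "j = length xs"
    using assms ij(2,4) nth_eq_iff_index_eq[OF assms, of j "length xs"] by simp
  thus "b \<in> set xs" using ij by (auto simp: nth_append)
next
  assume "b \<in> set xs"
  then obtain i where "i < length xs" "xs ! i = b" by (auto simp: in_set_conv_nth)
  thus "prefers (xs @ a # ys) b a"
    unfolding prefers_def by (intro exI[of _ i] exI[of _ "length xs"]) (auto simp: nth_append)
qed

lemma prefers_afterI:
  assumes "b \<in> set ys"
  shows "prefers (xs @ a # ys) a b"
proof -
  obtain i where "i < length ys" "ys ! i = b" using assms by (auto simp: in_set_conv_nth)
  thus ?thesis
    unfolding prefers_def
    by (intro exI[of _ "length xs"] exI[of _ "Suc (length xs + i)"]) (auto simp: nth_append)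
qed

text \<open>One format serves both sides: women use X and men the converse of Y. The image of i
  under R is the set that i would leave the partner of the same index for.\<close>

definition pref_profile :: "nat \<Rightarrow> (nat \<times> nat) set \<Rightarrow> profile" where
  "pref_profile n R i = (if i < n then pref_list n (R `` {i}) i else [])"

text \<open>Irreflexivity keeps i out of its own upper block, so the list has no duplicates.\<close>

lemma pref_profile_in_profiles:
  assumes "irrefl R"
  shows "pref_profile n R \<in> profiles n"
  using assms by (auto simp: profiles_def pref_profile_def pref_list_def irrefl_def)

lemma prefers_to_own_index_iff:
  assumes "irrefl R" "i < n" "j < n"
  shows "prefers (pref_profile n R i) j i \<longleftrightarrow> (i, j) \<in> R"
  using assms
  by (simp add: pref_profile_def pref_list_def) (subst prefers_before_iff; auto simp: irrefl_def)

lemma prefers_own_index: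
  assumes "i < n" "j < n" "j \<noteq> i" "(i, j) \<notin> R"
  shows "prefers (pref_profile n R i) i j"
  using assms by (auto simp: pref_profile_def pref_list_def intro!: prefers_afterI)

text \<open>Uniqueness rests on men below k and women from k on having empty upper blocks: they rank
  the partner of their own index first. Hence a woman below k or a man from k on who is not matched
  to that partner must be matched inside the own upper block, and disjointness of X and Y rules this
  out.\<close>

lemma stable_pref_profiles_iff:
  assumes X: "X \<subseteq> {0..<k} \<times> {k..<n}" and Y: "Y \<subseteq> {0..<k} \<times> {k..<n}" and k: "k \<le> n"
    and mu: "stable n (pref_profile n X) (pref_profile n (Y\<inverse>)) mu"
  shows "(\<forall>i<n. mu i = i) \<longleftrightarrow> X \<inter> Y = {}"
proof -
  have irr: "irrefl X" "irrefl (Y\<inverse>)" using X Y by (force simp: irrefl_def)+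
  have bij: "bij_betw mu {0..<n} {0..<n}" using mu by (simp add: stable_def perfect_marriage_def)
  hence inj: "inj_on mu {0..<n}" and img: "mu ` {0..<n} = {0..<n}" by (auto simp: bij_betw_def)
  define nu where "nu = the_inv_into {0..<n} mu"
  have nu: "nu (mu w) = w" "mu w < n" if "w < n" for w
    using that inj img by (auto simp: nu_def the_inv_into_f_f)
  have mu_nu: "mu (nu m) = m" "nu m < n" if "m < n" for m
    using that inj img f_the_inv_into_f[OF inj, of m] the_inv_into_into[OF inj, of m "{0..<n}"]
    by (auto simp: nu_def)
  have noblock: "\<not> (prefers (pref_profile n X w) m (mu w) \<and> prefers (pref_profile n (Y\<inverse>) m) w (nu m))"
    if "w < n" "m < n" for w m
    using mu that by (auto simp: stable_def blocking_pair_def nu_def)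
  show ?thesis
  proof
    assume id: "\<forall>i<n. mu i = i"
    hence nuid: "nu i = i" if "i < n" for i using nu[OF that] that by simp
    show "X \<inter> Y = {}"
    proof (rule ccontr)
      assume "X \<inter> Y \<noteq> {}"
      then obtain w m where wm: "(w, m) \<in> X" "(w, m) \<in> Y" by auto
      hence "w < n" "m < n" using X k by auto
      thus False
        using noblock[of w m] wm id nuid irr by (simp add: prefers_to_own_index_iff)
    qed
  next
    assume disj: "X \<inter> Y = {}"
    \<comment> \<open>The candidate blocking pair is (w, w): man w, of index below k, ranks woman w
      first.\<close>
    have womanX: "(w, mu w) \<in> X" if w: "w < k" "mu w \<noteq> w" for w
    proof -
      have wn: "w < n" using w k by simp
      have "nu w \<noteq> w" using mu_nu[OF wn] w by metis
      moreover have "(w, nu w) \<notin> Y\<inverse>" using Y w by auto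
      ultimately have "prefers (pref_profile n (Y\<inverse>) w) w (nu w)"
        using wn mu_nu by (intro prefers_own_index) auto
      hence "\<not> prefers (pref_profile n X w) w (mu w)" using noblock wn by blast
      thus ?thesis using prefers_own_index[of w n "mu w" X] wn nu w by blast
    qed
    \<comment> \<open>Mirror image with the pair (m, m): woman m, of index at least k, ranks man m
      first.\<close>
    have manY: "(nu m, m) \<in> Y" if m: "m \<ge> k" "m < n" "mu m \<noteq> m" for m
    proof -
      have "nu m \<noteq> m" using mu_nu[OF m(2)] m by metis
      have "prefers (pref_profile n X m) m (mu m)"
        using m nu X by (intro prefers_own_index) auto
      hence "\<not> prefers (pref_profile n (Y\<inverse>) m) m (nu m)" using noblock m by blast
      thus ?thesis using prefers_own_index[of m n "nu m" "Y\<inverse>"] m mu_nu \<open>nu m \<noteq> m\<close> by blast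
    qed
    have low: "mu w = w" if w: "w < k" for w
    proof (rule ccontr)
      assume ne: "mu w \<noteq> w"
      have wX: "(w, mu w) \<in> X" using womanX w ne by blast
      hence m: "mu w \<ge> k" "mu w < n" using X by auto
      have wn: "w < n" using w k by simp
      \<comment> \<open>By injectivity the man \<open>mu w\<close> is not matched to his own index
        either, so \<open>manY\<close> puts the pair (w, mu w) into Y as well.\<close>
      have "mu (mu w) \<noteq> mu w" using inj_onD[OF inj, of "mu w" w] m wn ne by auto
      hence "(nu (mu w), mu w) \<in> Y" using manY m by blast
      thus False using wX disj nu wn by auto
    qed
    show "\<forall>i<n. mu i = i"
    proof (intro allI impI, rule ccontr)
      fix m assume m: "m < n" "mu m \<noteq> m"
      hence "m \<ge> k" using low[of m] by (cases "m < k") auto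
      \<comment> \<open>The wife of such a man has index below k, and by \<open>low\<close> she is
        matched to her own index.\<close>
      hence "(nu m, m) \<in> Y" using manY m by blast
      hence "nu m < k" "m \<ge> k" using Y by auto
      thus False using low[of "nu m"] mu_nu[OF m(1)] by simp
    qed
  qed
qed

section \<open>The quadratic lower bound\<close>

lemma protocol_lower_bound:
  assumes f: "stable_mechanism n f"
    and D: "rand_protocol_computes D (profiles n) (profiles n) (is_identity_outcome n f) d"
    and n: "n \<ge> 2"
  shows "real d \<ge> (1 / 4608) * real n ^ 2"
proof -
  \<comment> \<open>The balanced split maximises the number k * (n - k) of coordinates.\<close>
  define k where "k = n div 2"
  define I where "I = {0..<k} \<times> {k..<n}"
  have k: "k \<le> n" by (simp add: k_def)
  have corr: "measure_pmf.prob D {t. run_protocol t (pref_profile n X) (pref_profile n (Y\<inverse>)) = (X \<inter> Y = {})} \<ge> 2 / 3"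
    if XY: "X \<subseteq> I" "Y \<subseteq> I" for X Y
  proof -
    have "irrefl X" "irrefl (Y\<inverse>)" using XY by (force simp: irrefl_def I_def)+
    hence P: "pref_profile n X \<in> profiles n" "pref_profile n (Y\<inverse>) \<in> profiles n"
      by (auto intro: pref_profile_in_profiles)
    hence "stable n (pref_profile n X) (pref_profile n (Y\<inverse>)) (f (pref_profile n X) (pref_profile n (Y\<inverse>)))"
      using f by (simp add: stable_mechanism_def)
    hence eq: "is_identity_outcome n f (pref_profile n X) (pref_profile n (Y\<inverse>)) \<longleftrightarrow> X \<inter> Y = {}"
      using stable_pref_profiles_iff[of X k n Y] XY k unfolding is_identity_outcome_def I_def by simp
    from D P have "2 / 3 \<le> measure_pmf.prob D {t. run_protocol t (pref_profile n X) (pref_profile n (Y\<inverse>))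
        = is_identity_outcome n f (pref_profile n X) (pref_profile n (Y\<inverse>))}"
      unfolding rand_protocol_computes_def by blast
    thus ?thesis unfolding eq .
  qed
  have "real (card I) \<le> 576 * real d"
  proof (rule rand_disjointness_lower_bound[where \<phi> = "pref_profile n" and \<psi> = "\<lambda>Y. pref_profile n (Y\<inverse>)"])
    fix X Y assume XY: "X \<subseteq> I" "Y \<subseteq> I" "X \<inter> Y \<noteq> {}"
    have "measure_pmf.prob D {t. \<not> run_protocol t (pref_profile n X) (pref_profile n (Y\<inverse>))} \<ge> 2 / 3"
      using corr[of X Y] XY by simp
    thus "measure_pmf.prob D {t. run_protocol t (pref_profile n X) (pref_profile n (Y\<inverse>))} \<le> 1 / 3"
      using measure_pmf.prob_compl[of "{t. run_protocol t (pref_profile n X) (pref_profile n (Y\<inverse>))}" D]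
      by (simp add: Compl_eq_Diff_UNIV[symmetric] Collect_neg_eq)
  next
    fix X Y assume XY: "X \<subseteq> I" "Y \<subseteq> I" "X \<inter> Y = {}"
    thus "measure_pmf.prob D {t. run_protocol t (pref_profile n X) (pref_profile n (Y\<inverse>))} \<ge> 2 / 3"
      using corr[of X Y] by simp
  qed (use D in \<open>auto simp: I_def rand_protocol_computes_def\<close>)
  moreover have "real n ^ 2 \<le> 8 * real (card I)"
  proof -
    \<comment> \<open>The factor 4 absorbs the rounding in n div 2, which needs n >= 2. The
      resulting 8 times 576 is the constant 4608.\<close>
    have "n \<le> 4 * k" "n \<le> 2 * (n - k)" using n by (auto simp: k_def)
    hence "n * n \<le> (4 * k) * (2 * (n - k))" by (rule mult_mono) auto
    hence "n * n \<le> 8 * (k * (n - k))" by simp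
    hence "real (n * n) \<le> real (8 * (k * (n - k)))" by (simp only: of_nat_le_iff)
    thus ?thesis by (simp add: I_def power2_eq_square)
  qed
  ultimately show ?thesis by simp
qed

theorem theorem25:
  fixes F :: "nat \<Rightarrow> (profile \<Rightarrow> profile \<Rightarrow> nat \<Rightarrow> nat)"
  assumes "\<And>n. stable_mechanism n (F n)"
  shows "\<exists>c > (0::real). \<exists>N. \<forall>n \<ge> N.
           (\<forall>D d. rand_query_computes D (profiles n) (profiles n) (is_identity_outcome n (F n)) d
                 \<longrightarrow> real d \<ge> c * real n ^ 2)
         \<and> (\<forall>D d. rand_protocol_computes D (profiles n) (profiles n) (is_identity_outcome n (F n)) d
                 \<longrightarrow> real d \<ge> c * real n ^ 2)"
proof (intro exI[of _ "1 / 4608 :: real"] exI[of _ "2 :: nat"] conjI allI impI)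
  fix n d :: nat and D assume n: "2 \<le> n"
    and D: "rand_query_computes D (profiles n) (profiles n) (is_identity_outcome n (F n)) d"
  show "real d \<ge> 1 / 4608 * real n ^ 2"
    using protocol_lower_bound[OF assms rand_protocol_of_rand_query[OF D] n] .
next
  fix n d :: nat and D assume n: "2 \<le> n"
    and D: "rand_protocol_computes D (profiles n) (profiles n) (is_identity_outcome n (F n)) d"
  show "real d \<ge> 1 / 4608 * real n ^ 2"
    using protocol_lower_bound[OF assms D n] .
qed simp

end
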